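(* Let $T$ be (the vertex set of) an infinite rooted tree without leaves. Suppose that $$\sum_{n=1}^\infty\frac{1}{\Delta_n(T)}<\infty .$$ Then the spectral measure of any branching-type stationary stochastic process on $T$ is absolutely continuous with respect to the Lebesgue measure $m$ on $\mathbb{T}$, and the corresponding Radon-Nikodym derivative is in $L^2(\mathbb{T},m)$.
   Context: $\mathbb{N}=\{0,1,2,\dots\}$, $\mathbb{T}=\mathbb{R}/2\pi\mathbb{Z}$. $T$ denotes the vertex set of an infinite rooted tree with root $e$ and graph distance $d$; "without leaves" means every vertex has at least one descendant. A rooted geodesic ray is an infinite geodesic $\xi=(\sigma_n)_{n\in\mathbb{N}}$ starting at $\sigma_0=e$; the set of these is $\partial T$, and each $\xi\in\partial T$ is identified with $\mathbb{N}$ via $\sigma_n\leftrightarrow n$. Two vertices are comparable if they lie on a common rooted geodesic ray; $\sigma_1\preccurlyeq\sigma_2$ means they are comparable and $d(\sigma_1,e)\le d(\sigma_2,e)$. For an integer $n\ge 1$, $$\Delta_n(T)=\sup_{\sigma\in T}\#\{\delta\in T:\ \sigma\preccurlyeq\delta,\ d(\sigma,\delta)=n\}\in\{1,2,\dots\}\cup\{\infty\},$$ with $1/\infty=0$. Random variables are complex-valued and, for mean-zero variables, $\mathrm{Cov}(X,Y)=\mathbb{E}(X\overline{Y})$. A mean-zero square-integrable process $(X_n)_{n\in\mathbb{N}}$ is (weakly) stationary if $\mathrm{Cov}(X_n,X_{n+k})$ does not depend on $n$, for all $n,k\in\mathbb{N}$; its spectral measure is the unique positive Radon measure $\nu$ on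 $\mathbb{T}$ with $\mathrm{Cov}(X_n,X_{n+k})=\int_{\mathbb{T}}e^{-ik\theta}d\nu(\theta)$ for all $n,k\in\mathbb{N}$. A mean-zero square-integrable process $(X_\sigma)_{\sigma\in T}$ is a branching-type stationary stochastic process on $T$ if: (i) for every $\xi\in\partial T$, the restriction $(X_\sigma)_{\sigma\in\xi}$ is stationary; (ii) all these restrictions have the same spectral measure, which is called the spectral measure of the process; (iii) $\mathrm{Cov}(X_\sigma,X_\tau)=0$ for all non-comparable $\sigma,\tau\in T$. *)

theory Defs
  imports "HOL-Probability.Probability"
begin

section \<open>Rooted trees\<close>

text \<open>
  Graphs are simple and undirected, with vertex set \<open>V\<close> and edges the two-element sets in \<open>E\<close>.
  No local finiteness is assumed.
\<close>

locale rooted_tree =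
  fixes V :: "'v set" and E :: "'v set set" and root :: 'v
  assumes edges: "e \<in> E \<Longrightarrow> \<exists>u\<in>V. \<exists>v\<in>V. u \<noteq> v \<and> e = {u, v}"
    and root_in_V: "root \<in> V"
    and connected: "\<lbrakk>u \<in> V; v \<in> V\<rbrakk> \<Longrightarrow>
          \<exists>p. p \<noteq> [] \<and> hd p = u \<and> last p = v \<and> set p \<subseteq> V \<and>
              successively (\<lambda>x y. {x, y} \<in> E) p"
    and acyclic: "\<not> (\<exists>c. 3 \<le> length c \<and> distinct c \<and> set c \<subseteq> V \<and>
              successively (\<lambda>x y. {x, y} \<in> E) c \<and> {last c, hd c} \<in> E)"
begin

definition walk :: "'v \<Rightarrow> 'v list \<Rightarrow> 'v \<Rightarrow> bool" where
  "walk u p v \<longleftrightarrow> p \<noteq> [] \<and> hd p = u \<and> last p = v \<and> set p \<subseteq> V \<and>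
     successively (\<lambda>x y. {x, y} \<in> E) p"

text \<open>A walk is given by its vertices, so its number of edges is one less than its list length.\<close>

definition gdist :: "'v \<Rightarrow> 'v \<Rightarrow> nat" where
  "gdist u v = (LEAST n. \<exists>p. walk u p v \<and> length p = Suc n)"

text \<open>
  A descendant of \<open>\<sigma>\<close> is a vertex other than \<open>\<sigma>\<close> whose geodesic from the root passes
  through \<open>\<sigma>\<close>. This is not phrased with the relation \<open>preceq\<close> below, which is only a useful
  notion once every vertex is known to lie on a ray.
\<close>

definition no_leaves :: bool where
  "no_leaves \<longleftrightarrow>
     (\<forall>\<sigma>\<in>V. \<exists>\<delta>\<in>V. \<delta> \<noteq> \<sigma> \<and> gdist root \<delta> = gdist root \<sigma> + gdist \<sigma> \<delta>)"

definition rooted_ray :: "(nat \<Rightarrow> 'v) \<Rightarrow> bool" where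
  "rooted_ray \<xi> \<longleftrightarrow> range \<xi> \<subseteq> V \<and> \<xi> 0 = root \<and>
     (\<forall>m n. m \<le> n \<longrightarrow> gdist (\<xi> m) (\<xi> n) = n - m)"

definition comparable :: "'v \<Rightarrow> 'v \<Rightarrow> bool" where
  "comparable \<sigma> \<tau> \<longleftrightarrow> (\<exists>\<xi>. rooted_ray \<xi> \<and> \<sigma> \<in> range \<xi> \<and> \<tau> \<in> range \<xi>)"

definition preceq :: "'v \<Rightarrow> 'v \<Rightarrow> bool" (infix \<open>\<preceq>\<close> 50) where
  "\<sigma> \<preceq> \<tau> \<longleftrightarrow> comparable \<sigma> \<tau> \<and> gdist \<sigma> root \<le> gdist \<tau> root"

text \<open>
  Counting measure gives the number of elements of a set, with value \<open>\<infinity>\<close> for infinite sets.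
\<close>

definition Delta :: "nat \<Rightarrow> ennreal" where
  "Delta n = (SUP \<sigma>\<in>V. emeasure (count_space UNIV) {\<delta>\<in>V. \<sigma> \<preceq> \<delta> \<and> gdist \<sigma> \<delta> = n})"

end


section \<open>Stationary processes and spectral measures\<close>

definition centered_L2_process ::
    "'w measure \<Rightarrow> 'i set \<Rightarrow> ('i \<Rightarrow> 'w \<Rightarrow> complex) \<Rightarrow> bool" where
  "centered_L2_process M I X \<longleftrightarrow>
     (\<forall>i\<in>I. X i \<in> borel_measurable M \<and> integrable M (\<lambda>\<omega>. (cmod (X i \<omega>))\<^sup>2) \<and>
        (LINT \<omega>|M. X i \<omega>) = 0)"

text \<open>This is the covariance of \<open>Y\<close> and \<open>Z\<close> only when both have mean zero.\<close>

definition cov :: "'w measure \<Rightarrow> ('w \<Rightarrow> complex) \<Rightarrow> ('w \<Rightarrow> complex) \<Rightarrow> complex" where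
  "cov M Y Z = (LINT \<omega>|M. Y \<omega> * cnj (Z \<omega>))"

definition stationary :: "'w measure \<Rightarrow> (nat \<Rightarrow> 'w \<Rightarrow> complex) \<Rightarrow> bool" where
  "stationary M Y \<longleftrightarrow> centered_L2_process M UNIV Y \<and>
     (\<forall>m n k. cov M (Y m) (Y (m + k)) = cov M (Y n) (Y (n + k)))"

text \<open>
  The circle \<open>\<real> / 2 \<pi> \<int>\<close> is represented by the fundamental domain \<open>[0, 2 \<pi>)\<close>: the projection
  onto the quotient restricts to a Borel isomorphism, under which Borel measures on the
  circle are Borel measures on \<open>[0, 2 \<pi>)\<close>. As the circle is compact and metrizable, its positive
  Radon measures are exactly its finite Borel measures. Lebesgue measure has total mass \<open>2 \<pi>\<close>.
\<close>

definition circle_borel :: "real measure" where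
  "circle_borel = restrict_space borel {0..<2 * pi}"

definition circle_lebesgue :: "real measure" where
  "circle_lebesgue = restrict_space lborel {0..<2 * pi}"

text \<open>
  The spectral measure is unique when it exists, so it is described by a predicate.
\<close>

definition is_spectral_measure ::
    "'w measure \<Rightarrow> (nat \<Rightarrow> 'w \<Rightarrow> complex) \<Rightarrow> real measure \<Rightarrow> bool" where
  "is_spectral_measure M Y \<nu> \<longleftrightarrow>
     finite_measure \<nu> \<and> sets \<nu> = sets circle_borel \<and>
     (\<forall>n k. cov M (Y n) (Y (n + k)) = (LINT \<theta>|\<nu>. exp (- \<i> * of_nat k * of_real \<theta>)))"


section \<open>Branching-type stationary processes\<close>

context rooted_tree
begin

definition process_spectral_measure ::
    "'w measure \<Rightarrow> ('v \<Rightarrow> 'w \<Rightarrow> complex) \<Rightarrow> real measure \<Rightarrow> bool" where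
  "process_spectral_measure M X \<nu> \<longleftrightarrow>
     (\<forall>\<xi>. rooted_ray \<xi> \<longrightarrow> is_spectral_measure M (\<lambda>n. X (\<xi> n)) \<nu>)"

definition branching_type_stationary ::
    "'w measure \<Rightarrow> ('v \<Rightarrow> 'w \<Rightarrow> complex) \<Rightarrow> bool" where
  "branching_type_stationary M X \<longleftrightarrow>
     centered_L2_process M V X \<and>
     (\<forall>\<xi>. rooted_ray \<xi> \<longrightarrow> stationary M (\<lambda>n. X (\<xi> n))) \<and>
     (\<exists>\<nu>. process_spectral_measure M X \<nu>) \<and>
     (\<forall>\<sigma>\<in>V. \<forall>\<tau>\<in>V. \<not> comparable \<sigma> \<tau> \<longrightarrow> cov M (X \<sigma>) (X \<tau>) = 0)"

end

end

theory Submission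
  imports Defs
begin

text \<open>
  Write \<open>r n = \<integral> e\<^sup>-\<^sup>i\<^sup>n\<^sup>\<theta> d\<nu>\<close>. Fix a vertex \<open>\<sigma>\<close> and any \<open>N\<close> of its descendants at distance \<open>n\<close>.
  These descendants lie on one level of the tree, so they are pairwise non-comparable and their
  variables are orthogonal; each has variance \<open>r 0\<close> and the same covariance \<open>r n\<close> with the
  variable at \<open>\<sigma>\<close>, which has variance \<open>r 0\<close> too. Bessel's inequality gives
  \<open>N |r n|\<^sup>2 \<le> (r 0)\<^sup>2\<close>. Taking the supremum over the finite families and over \<open>\<sigma>\<close> yields
  \<open>\<Delta>\<^sub>n |r n|\<^sup>2 \<le> (r 0)\<^sup>2\<close> (\<open>Delta_mult_cov_le\<close>), so the hypothesis on \<open>\<Delta>\<^sub>n\<close> makes the Fourier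
  coefficients of \<open>\<nu>\<close> square summable.

  It remains to see that a finite measure \<open>\<nu>\<close> on the circle with square summable Fourier
  coefficients has a square integrable density. This is done by duality. If \<open>S\<close> bounds the sum of
  the squared coefficients, Cauchy-Schwarz and Parseval give
  \<open>(\<integral> f d\<nu>)\<^sup>2 \<le> (S / 2\<pi>) \<integral> f\<^sup>2 dm\<close> for real trigonometric polynomials \<open>f\<close>. This inequality
  survives bounded almost everywhere limits, provided that they hold for both \<open>m\<close> and \<open>\<nu>\<close>
  (\<open>L2_dominated_limit\<close>), and it is propagated in four steps: to continuous functions on the circle
  by Stone-Weierstrass; to all bounded continuous functions on \<open>[0, 2\<pi>)\<close>, once the endpoint has
  been shown to have no mass; to indicators of compact sets, which by inner regularity makes \<open>\<nu>\<close>
  absolutely continuous; and to bounded Borel functions, which are Lebesgue almost everywhere,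
  hence now also \<open>\<nu>\<close>-almost everywhere, limits of continuous ones. Finally, applied to the
  truncations \<open>min h n\<close> of the density \<open>h\<close>, the inequality bounds \<open>\<integral> (min h n)\<^sup>2 dm\<close> by
  \<open>S / 2\<pi>\<close> for every \<open>n\<close>, and monotone convergence concludes.
\<close>

section \<open>Trigonometric polynomials\<close>

definition trig_polynomial :: "(real \<Rightarrow> complex) \<Rightarrow> bool" where
  "trig_polynomial p \<longleftrightarrow>
     (\<exists>K c. finite K \<and> p = (\<lambda>\<theta>. \<Sum>k\<in>K. c k * cis (of_int k * \<theta>)))"

lemma trig_polynomial_monomial: "trig_polynomial (\<lambda>\<theta>. a * cis (of_int k * \<theta>))"
  unfolding trig_polynomial_def by (rule exI[of _ "{k}"], rule exI[of _ "\<lambda>_. a"]) auto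

lemma trig_polynomial_add:
  assumes "trig_polynomial p" "trig_polynomial q"
  shows "trig_polynomial (\<lambda>\<theta>. p \<theta> + q \<theta>)"
proof -
  obtain K c where K: "finite K" "p = (\<lambda>\<theta>. \<Sum>k\<in>K. c k * cis (of_int k * \<theta>))"
    using assms(1) unfolding trig_polynomial_def by blast
  obtain L d where L: "finite L" "q = (\<lambda>\<theta>. \<Sum>k\<in>L. d k * cis (of_int k * \<theta>))"
    using assms(2) unfolding trig_polynomial_def by blast
  let ?c = "\<lambda>k. if k \<in> K then c k else 0" and ?d = "\<lambda>k. if k \<in> L then d k else 0"
  have p: "p \<theta> = (\<Sum>k\<in>K \<union> L. ?c k * cis (of_int k * \<theta>))" for \<theta>
    unfolding K(2) using K(1) L(1) by (intro sum.mono_neutral_cong_left) auto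
  have q: "q \<theta> = (\<Sum>k\<in>K \<union> L. ?d k * cis (of_int k * \<theta>))" for \<theta>
    unfolding L(2) using K(1) L(1) by (intro sum.mono_neutral_cong_left) auto
  have "(\<lambda>\<theta>. p \<theta> + q \<theta>) = (\<lambda>\<theta>. \<Sum>k\<in>K \<union> L. (?c k + ?d k) * cis (of_int k * \<theta>))"
    unfolding p q by (simp only: sum.distrib[symmetric] distrib_right)
  then show ?thesis
    unfolding trig_polynomial_def using K(1) L(1)
    by (intro exI[of _ "K \<union> L"] exI[of _ "\<lambda>k. ?c k + ?d k"] conjI finite_UnI)
qed

lemma trig_polynomial_sum:
  assumes "finite K" "\<And>k. k \<in> K \<Longrightarrow> trig_polynomial (p k)"
  shows "trig_polynomial (\<lambda>\<theta>. \<Sum>k\<in>K. p k \<theta>)"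
  using assms
proof (induction K rule: finite_induct)
  case empty
  show ?case using trig_polynomial_monomial[of 0 0] by simp
qed (auto intro: trig_polynomial_add)

lemma trig_polynomial_mult:
  assumes "trig_polynomial p" "trig_polynomial q"
  shows "trig_polynomial (\<lambda>\<theta>. p \<theta> * q \<theta>)"
proof -
  obtain K c where K: "finite K" "p = (\<lambda>\<theta>. \<Sum>k\<in>K. c k * cis (of_int k * \<theta>))"
    using assms(1) unfolding trig_polynomial_def by blast
  obtain L d where L: "finite L" "q = (\<lambda>\<theta>. \<Sum>k\<in>L. d k * cis (of_int k * \<theta>))"
    using assms(2) unfolding trig_polynomial_def by blast
  have "(\<lambda>\<theta>. p \<theta> * q \<theta>) =
      (\<lambda>\<theta>. \<Sum>k\<in>K. \<Sum>l\<in>L. (c k * d l) * cis (of_int (k + l) * \<theta>))"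
    unfolding K(2) L(2) by (simp add: sum_product distrib_right flip: cis_mult) (simp add: mult_ac)
  moreover have "trig_polynomial \<dots>"
    using K(1) L(1) by (intro trig_polynomial_sum trig_polynomial_monomial)
  ultimately show ?thesis by simp
qed

text \<open>
  The coordinates of \<open>cis \<theta>\<close> are combinations of \<open>cis \<theta>\<close> and \<open>cis (- \<theta>)\<close>, and trigonometric
  polynomials form an algebra. So the restriction of a polynomial in two real variables to the unit
  circle is one of them, and uniform approximation on the circle reduces to Stone-Weierstrass.
\<close>

lemma trig_polynomial_of_real_polynomial:
  fixes q :: "complex \<Rightarrow> real"
  assumes "real_polynomial_function q"
  shows "trig_polynomial (\<lambda>\<theta>. complex_of_real (q (cis \<theta>)))"
  using assms
proof induction
  case (linear f)
  then interpret f: bounded_linear f .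
  define a where "a = complex_of_real (f 1)"
  define b where "b = complex_of_real (f \<i>)"
  have "complex_of_real (f (cis \<theta>)) =
      (a - \<i> * b) / 2 * cis (of_int 1 * \<theta>) + (a + \<i> * b) / 2 * cis (of_int (- 1) * \<theta>)" for \<theta>
  proof -
    have "cis \<theta> = cos \<theta> *\<^sub>R 1 + sin \<theta> *\<^sub>R \<i>"
      by (auto simp: complex_eq_iff)
    then have "f (cis \<theta>) = cos \<theta> * f 1 + sin \<theta> * f \<i>"
      by (metis f.add f.scale real_scaleR_def)
    then show ?thesis
      by (simp add: complex_eq_iff a_def b_def field_simps)
  qed
  then show ?case
    by (simp only:) (intro trig_polynomial_add trig_polynomial_monomial)
next
  case (const c)
  show ?case using trig_polynomial_monomial[of "complex_of_real c" 0] by simp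
qed (auto intro: trig_polynomial_add trig_polynomial_mult)

section \<open>Fourier analysis on the circle\<close>

lemma space_circle_lebesgue: "space circle_lebesgue = {0..<2 * pi}"
  by (simp add: circle_lebesgue_def space_restrict_space)

lemma sets_circle_lebesgue: "sets circle_lebesgue = sets circle_borel"
  by (simp add: circle_lebesgue_def circle_borel_def sets_restrict_space)

lemma finite_measure_circle_lebesgue: "finite_measure circle_lebesgue"
  by (rule finite_measureI)
    (simp add: circle_lebesgue_def space_restrict_space emeasure_restrict_space)

lemma measurable_circle:
  assumes "sets \<nu> = sets circle_borel" "f \<in> borel_measurable borel"
  shows "f \<in> borel_measurable \<nu>"
  using measurable_restrict_space1[OF assms(2), of "{0..<2*pi}"] assms(1) 
  by (simp add: circle_borel_def cong: measurable_cong_sets)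

lemma measurable_cis [measurable]: "(\<lambda>\<theta>. cis (of_int k * \<theta>)) \<in> borel_measurable borel"
  by (intro borel_measurable_continuous_onI continuous_intros)

lemma integral_cis_circle:
  "(LINT \<theta>|circle_lebesgue. cis (of_int k * \<theta>)) = (if k = 0 then of_real (2 * pi) else 0)"
proof -
  have "(LINT \<theta>|circle_lebesgue. cis (of_int k * \<theta>)) =
      (LINT \<theta>|lborel. indicator {0..<2 * pi} \<theta> *\<^sub>R cis (of_int k * \<theta>))"
    unfolding circle_lebesgue_def by (subst integral_restrict_space) auto
  also have "\<dots> = (LINT \<theta>|lborel. indicator {0..2 * pi} \<theta> *\<^sub>R cis (of_int k * \<theta>))"
  proof (rule integral_cong_AE)
    show "AE x in lborel. indicator {0..<2 * pi} x *\<^sub>R cis (of_int k * x) =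
        indicator {0..2 * pi} x *\<^sub>R cis (of_int k * x)"
      using AE_lborel_singleton[of "2 * pi"] by eventually_elim (auto simp: indicator_def)
  qed (auto intro!: borel_measurable_scaleR measurable_cis)
  also have "\<dots> = (if k = 0 then of_real (2 * pi) else 0)"
  proof (cases "k = 0")
    case True
    then show ?thesis by (simp add: scaleR_conv_of_real)
  next
    case False
    \<comment> \<open>an antiderivative of the integrand, of period \<open>2 \<pi>\<close> because \<open>k\<close> is a nonzero integer\<close>
    define F where "F \<theta> = cis (of_int k * \<theta>) / (\<i> * of_int k)" for \<theta>
    have "(LINT \<theta>|lborel. indicator {0..2 * pi} \<theta> *\<^sub>R cis (of_int k * \<theta>)) = F (2 * pi) - F 0"
    proof (rule integral_FTC_atLeastAtMost)
      fix x :: real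
      have "((\<lambda>\<theta>. cis (of_int k * \<theta>)) has_derivative
          (\<lambda>t. (of_int k * t) *\<^sub>R (\<i> * cis (of_int k * x)))) (at x within {0..2 * pi})"
        by (intro derivative_intros)
      then have "((\<lambda>\<theta>. cis (of_int k * \<theta>)) has_vector_derivative
          \<i> * of_int k * cis (of_int k * x)) (at x within {0..2 * pi})"
        unfolding has_vector_derivative_def
        by (rule has_derivative_eq_rhs) (auto simp: scaleR_conv_of_real)
      then have "((\<lambda>\<theta>. cis (of_int k * \<theta>) / (\<i> * of_int k)) has_vector_derivative
          \<i> * of_int k * cis (of_int k * x) / (\<i> * of_int k)) (at x within {0..2 * pi})"
        by (rule has_vector_derivative_divide)
      then show "(F has_vector_derivative cis (of_int k * x)) (at x within {0..2*pi})"
        using False by (simp add: F_def[abs_def])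
    qed (auto intro!: continuous_intros)
    moreover have "cis (of_int k * (2 * pi)) = 1"
      using cis_multiple_2pi[of "of_int k"] by (simp add: mult.commute)
    ultimately show ?thesis using False by (simp only: F_def) simp
  qed
  finally show ?thesis .
qed

lemma integrable_bounded_circle:
  fixes f :: "real \<Rightarrow> 'b :: {banach, second_countable_topology}"
  assumes "finite_measure \<nu>" "sets \<nu> = sets circle_borel" "f \<in> borel_measurable borel"
    and "\<And>x. norm (f x) \<le> B"
  shows "integrable \<nu> f"
proof -
  interpret finite_measure \<nu> by fact
  show ?thesis
    using assms by (intro integrable_const_bound[of _ B]) (auto intro: measurable_circle)
qed

lemma Parseval_trig_polynomial:
  assumes "finite K"
  shows "(LINT \<theta>|circle_lebesgue. (cmod (\<Sum>k\<in>K. c k * cis (of_int k * \<theta>)))\<^sup>2) =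
      2 * pi * (\<Sum>k\<in>K. (cmod (c k))\<^sup>2)"
proof -
  have int: "integrable circle_lebesgue (\<lambda>\<theta>. cis (of_int k * \<theta>))" for k
    by (rule integrable_bounded_circle[where B = 1])
      (auto simp: finite_measure_circle_lebesgue sets_circle_lebesgue)
  have "complex_of_real (LINT \<theta>|circle_lebesgue. (cmod (\<Sum>k\<in>K. c k * cis (of_int k * \<theta>)))\<^sup>2) =
      (LINT \<theta>|circle_lebesgue. of_real ((cmod (\<Sum>k\<in>K. c k * cis (of_int k * \<theta>)))\<^sup>2))"
    by (rule integral_complex_of_real[symmetric])
  also have "\<dots> = (LINT \<theta>|circle_lebesgue.
      (\<Sum>k\<in>K. \<Sum>l\<in>K. (c k * cnj (c l)) * cis (of_int (k - l) * \<theta>)))"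
  proof (intro arg_cong[where f = "integral\<^sup>L circle_lebesgue"] ext)
    fix \<theta> :: real
    have e: "cis (of_int k * \<theta>) * cnj (cis (of_int l * \<theta>)) = cis (of_int (k - l) * \<theta>)" for k l
      by (simp add: cis_cnj cis_mult left_diff_distrib)
    show "complex_of_real ((cmod (\<Sum>k\<in>K. c k * cis (of_int k * \<theta>)))\<^sup>2) =
        (\<Sum>k\<in>K. \<Sum>l\<in>K. (c k * cnj (c l)) * cis (of_int (k - l) * \<theta>))"
      unfolding complex_norm_square cnj_sum sum_product complex_cnj_mult e[symmetric]
      by (simp only: mult_ac)
  qed
  also have "\<dots> = (\<Sum>k\<in>K. \<Sum>l\<in>K. (c k * cnj (c l)) * (if k - l = 0 then of_real (2 * pi) else 0))"
    using int
    by (simp only: Bochner_Integration.integral_sum Bochner_Integration.integrable_sum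
        integrable_mult_right integral_mult_right_zero integral_cis_circle)
  also have "\<dots> = (\<Sum>k\<in>K. (c k * cnj (c k)) * of_real (2 * pi))"
  proof (rule sum.cong)
    fix k assume "k \<in> K"
    then have "(\<Sum>l\<in>K. (c k * cnj (c l)) * (if k - l = 0 then of_real (2 * pi) else 0)) =
        (\<Sum>l\<in>{k}. (c k * cnj (c l)) * (if k - l = 0 then of_real (2 * pi) else 0))"
      using assms by (intro sum.mono_neutral_right) auto
    then show "(\<Sum>l\<in>K. (c k * cnj (c l)) * (if k - l = 0 then of_real (2 * pi) else 0)) =
        (c k * cnj (c k)) * of_real (2 * pi)"
      by simp
  qed simp
  also have "\<dots> = (\<Sum>k\<in>K. complex_of_real ((cmod (c k))\<^sup>2)) * of_real (2 * pi)"
    unfolding complex_norm_square sum_distrib_right ..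
  also have "\<dots> = complex_of_real (2 * pi * (\<Sum>k\<in>K. (cmod (c k))\<^sup>2))"
    by (simp only: of_real_mult of_real_sum mult.commute)
  finally show ?thesis by (simp only: of_real_eq_iff)
qed

text \<open>
  The map \<open>cis\<close> exhibits the circle as the quotient of \<open>[0, 2\<pi>]\<close> by its endpoints: it is a
  continuous surjection from a compact space onto a Hausdorff space, hence a quotient map. So \<open>g\<close>,
  which agrees at the two endpoints, descends to a continuous function on the circle.
\<close>

lemma trig_polynomial_uniform_approx:
  fixes g :: "real \<Rightarrow> real"
  assumes g: "continuous_on {0..2 * pi} g" and loop: "g 0 = g (2 * pi)" and e: "0 < e"
  obtains f where "trig_polynomial (\<lambda>\<theta>. complex_of_real (f \<theta>))"
    and "\<And>\<theta>. \<theta> \<in> {0..2 * pi} \<Longrightarrow> \<bar>g \<theta> - f \<theta>\<bar> < e"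
proof -
  let ?I = "top_of_set {0..2 * pi}" and ?S = "top_of_set (sphere (0::complex) 1)"
  have onto: "cis ` {0..2 * pi} = sphere 0 1"
  proof (intro equalityI subsetI)
    fix z :: complex assume "z \<in> sphere 0 1"
    then have "z = cis (Arg2pi z)"
      using complex_norm_eq_1_exp[of z] by (simp add: cis_conv_exp)
    then show "z \<in> cis ` {0..2 * pi}"
      using Arg2pi[of z] by (intro image_eqI) auto
  qed (auto simp: dist_norm)
  have "quotient_map ?I ?S cis"
  proof (rule continuous_imp_quotient_map)
    show "continuous_map ?I ?S cis"
      using onto by (auto intro!: continuous_intros)
    show "compact_space ?I" by (simp add: compact_space_subtopology)
    show "Hausdorff_space ?S" by (simp add: Hausdorff_space_subtopology)
  qed (use onto in auto)
  moreover have "continuous_map ?I euclideanreal g" using g by simp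
  moreover have "g x = g y" if xy: "x \<in> topspace ?I" "y \<in> topspace ?I" "cis x = cis y" for x y
  proof -
    have Arg: "Arg2pi (cis x) = x" if "0 \<le> x" "x < 2 * pi" for x
      using that by (intro Arg2pi_unique[of 1]) (auto simp: cis_conv_exp)
    \<comment> \<open>\<open>Arg2pi\<close> inverts \<open>cis\<close> off \<open>2 \<pi>\<close>; a point \<open>2 \<pi>\<close> is replaced by \<open>0\<close>, which has the same images\<close>
    have red: "\<exists>x'. 0 \<le> x' \<and> x' < 2 * pi \<and> cis x' = cis x \<and> g x' = g x"
      if "x \<in> {0..2 * pi}" for x
      using that loop by (cases "x = 2 * pi") (force intro: exI[of _ 0] exI[of _ x])+
    obtain x' y' where "0 \<le> x'" "x' < 2 * pi" "cis x' = cis x" "g x' = g x"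
      "0 \<le> y'" "y' < 2 * pi" "cis y' = cis y" "g y' = g y"
      using red[of x] red[of y] xy(1,2) unfolding topspace_euclidean_subtopology by metis
    then show ?thesis using Arg[of x'] Arg[of y'] \<open>cis x = cis y\<close> by metis
  qed
  ultimately obtain G where G: "continuous_map ?S euclideanreal G"
      and Gg: "\<And>x. x \<in> topspace ?I \<Longrightarrow> G (cis x) = g x"
    by (rule quotient_map_lift_exists) auto
  obtain q where q: "real_polynomial_function q"
      "\<And>z. z \<in> sphere 0 1 \<Longrightarrow> \<bar>G z - q z\<bar> < e"
    using Stone_Weierstrass_real_polynomial_function[of "sphere (0::complex) 1" G e] G e by auto
  show ?thesis
  proof (rule that)
    show "trig_polynomial (\<lambda>\<theta>. complex_of_real (q (cis \<theta>)))"
      using q(1) by (rule trig_polynomial_of_real_polynomial)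
    show "\<bar>g \<theta> - q (cis \<theta>)\<bar> < e" if "\<theta> \<in> {0..2 * pi}" for \<theta>
      using q(2)[of "cis \<theta>"] Gg[of \<theta>] that by simp
  qed
qed

section \<open>Functionals dominated by an \<open>L\<^sup>2\<close> norm\<close>

text \<open>
  The inequality says that integration against \<open>N\<close> is bounded by \<open>sqrt C\<close> times the norm of
  \<open>L\<^sup>2(M)\<close>, for a single function \<open>f\<close>. It is squared so that limits can be taken without roots.
\<close>

definition L2_dominated :: "real \<Rightarrow> 'a measure \<Rightarrow> 'a measure \<Rightarrow> ('a \<Rightarrow> real) \<Rightarrow> bool" where
  "L2_dominated C M N f \<longleftrightarrow> (LINT x|N. f x)\<^sup>2 \<le> C * (LINT x|M. (f x)\<^sup>2)"

text \<open>
  Dominated convergence applies to both sides. The limit has to hold almost everywhere for each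
  of the two measures, as they are not yet comparable when this is first used.
\<close>

lemma L2_dominated_limit:
  assumes M: "finite_measure M" and N: "finite_measure N" and sets: "sets N = sets M"
    and u: "\<And>n::nat. u n \<in> borel_measurable M" and f: "f \<in> borel_measurable M"
    and bound: "\<And>n x. x \<in> space M \<Longrightarrow> \<bar>u n x\<bar> \<le> B"
    and limM: "AE x in M. (\<lambda>n. u n x) \<longlonglongrightarrow> f x" and limN: "AE x in N. (\<lambda>n. u n x) \<longlonglongrightarrow> f x"
    and dom: "\<And>n. L2_dominated C M N (u n)"
  shows "L2_dominated C M N f"
proof -
  interpret M: finite_measure M by fact
  interpret N: finite_measure N by fact
  have uN: "u n \<in> borel_measurable N" and fN: "f \<in> borel_measurable N" for n
    using u f sets by (simp_all cong: measurable_cong_sets)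
  have space: "space N = space M" using sets by (rule sets_eq_imp_space_eq)
  have N_lim: "(\<lambda>n. LINT x|N. u n x) \<longlonglongrightarrow> (LINT x|N. f x)"
    by (rule integral_dominated_convergence[where w = "\<lambda>_. B"])
      (use uN fN limN bound space in auto)
  have M_lim: "(\<lambda>n. LINT x|M. (u n x)\<^sup>2) \<longlonglongrightarrow> (LINT x|M. (f x)\<^sup>2)"
  proof (rule integral_dominated_convergence[where w = "\<lambda>_. B\<^sup>2"])
    show "AE x in M. (\<lambda>n. (u n x)\<^sup>2) \<longlonglongrightarrow> (f x)\<^sup>2"
      using limM by eventually_elim (rule tendsto_power)
    have "(u n x)\<^sup>2 \<le> B\<^sup>2" if "x \<in> space M" for n x
      using power_mono[OF bound[OF that, of n], of 2] by simp
    then show "AE x in M. norm ((u n x)\<^sup>2) \<le> B\<^sup>2" for n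
      by (auto intro!: AE_I2)
  qed (use u f in auto)
  show ?thesis
    unfolding L2_dominated_def
    by (rule LIMSEQ_le[OF tendsto_power[OF N_lim] tendsto_mult[OF tendsto_const M_lim]])
      (use dom in \<open>auto simp: L2_dominated_def\<close>)
qed

text \<open>
  If \<open>h\<close> is the density and \<open>f = min h n\<close>, then \<open>\<integral> f\<^sup>2 dM \<le> \<integral> f h dM = \<integral> f dN\<close>. The hypothesis
  bounds the square of the right-hand side by \<open>C \<integral> f\<^sup>2 dM\<close>. As \<open>\<integral> f\<^sup>2 dM\<close> is finite, it can be
  cancelled, which leaves \<open>\<integral> f\<^sup>2 dM \<le> C\<close> for each \<open>n\<close>.
\<close>

lemma nn_integral_RN_deriv_square_le:
  assumes M: "finite_measure M" and N: "finite_measure N" and sets: "sets N = sets M"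
    and ac: "absolutely_continuous M N" and C: "0 \<le> C"
    and dom: "\<And>f B. \<lbrakk>f \<in> borel_measurable M; \<And>x. \<bar>f x\<bar> \<le> B\<rbrakk> \<Longrightarrow> L2_dominated C M N f"
  shows "(\<integral>\<^sup>+x. (RN_deriv M N x)\<^sup>2 \<partial>M) \<le> ennreal C"
proof -
  interpret M: finite_measure M by fact
  interpret N: finite_measure N by fact
  define h where "h = RN_deriv M N"
  have h[measurable]: "h \<in> borel_measurable M" unfolding h_def by simp
  define u where "u n x = enn2real (min (h x) (of_nat n))" for n x
  have u[measurable]: "u n \<in> borel_measurable M" for n unfolding u_def by measurable
  have uN: "u n \<in> borel_measurable N" for n using u sets by (simp cong: measurable_cong_sets)
  have u0: "0 \<le> u n x" for n x by (simp add: u_def)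
  have fin: "min (h x) (of_nat n) < top" for n x
    by (rule le_less_trans[of _ "of_nat n"]) (auto simp: of_nat_less_top)
  have eu: "ennreal (u n x) = min (h x) (of_nat n)" for n x
    using fin by (simp add: u_def)
  have un: "u n x \<le> real n" for n x
    unfolding u_def by (rule enn2real_leI) (auto simp: ennreal_of_nat_eq_real_of_nat)
  have int2: "integrable M (\<lambda>x. (u n x)\<^sup>2)" for n
    using u0 un by (intro M.integrable_const_bound[of _ "(real n)\<^sup>2"])
      (auto intro!: AE_I2 power_mono)
  have int1: "integrable N (u n)" for n
    using u0 un uN by (intro N.integrable_const_bound[of _ "real n"]) auto
  have step: "(\<integral>\<^sup>+x. (min (h x) (of_nat n))\<^sup>2 \<partial>M) \<le> ennreal C" for n
  proof -
    let ?I = "LINT x|M. (u n x)\<^sup>2" and ?J = "LINT x|N. u n x"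
    have I: "(\<integral>\<^sup>+x. (min (h x) (of_nat n))\<^sup>2 \<partial>M) = ennreal ?I"
      using int2 u0 by (simp add: nn_integral_eq_integral[symmetric] ennreal_power eu[symmetric])
    have "ennreal ?I \<le> (\<integral>\<^sup>+x. h x * ennreal (u n x) \<partial>M)"
      unfolding I[symmetric] eu by (intro nn_integral_mono) (auto simp: power2_eq_square intro: mult_right_mono)
    also have "\<dots> = (\<integral>\<^sup>+x. ennreal (u n x) \<partial>N)"
      unfolding h_def by (rule M.RN_deriv_nn_integral[OF ac sets, symmetric]) simp
    also have "\<dots> = ennreal ?J"
      using int1 u0 by (simp add: nn_integral_eq_integral)
    finally have IJ: "?I \<le> ?J" using u0 by simp
    have "0 \<le> ?I" by simp
    then have "?I * ?I \<le> ?J\<^sup>2"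
      using IJ unfolding power2_eq_square[of ?J] by (intro mult_mono) linarith+
    also have "\<dots> \<le> C * ?I"
      using dom[of "u n" "real n"] u0 un by (simp add: L2_dominated_def)
    finally have "?I \<le> C" using \<open>0 \<le> ?I\<close> C by (cases "?I = 0") auto
    then show ?thesis using I by (simp add: ennreal_leI)
  qed
  have "(h x)\<^sup>2 \<le> (SUP n. (min (h x) (of_nat n))\<^sup>2)" for x
  proof (cases "h x = top")
    case True
    have "(of_nat n :: ennreal) \<le> (of_nat n)\<^sup>2" for n
      by (cases n) (auto simp: power2_eq_square of_nat_mult[symmetric] simp del: of_nat_mult of_nat_Suc)
    then have "(SUP n. of_nat n :: ennreal) \<le> (SUP n. (of_nat n)\<^sup>2)" by (intro SUP_mono) auto
    then show ?thesis using True by (simp add: ennreal_SUP_of_nat_eq_top top_unique)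
  next
    case False
    then obtain n where "h x \<le> of_nat n"
      using ennreal_Ex_less_of_nat[of "h x"] by (auto simp: less_top intro: less_imp_le)
    then have "(h x)\<^sup>2 = (min (h x) (of_nat n))\<^sup>2" by (simp add: min_def)
    then show ?thesis by (metis SUP_upper UNIV_I)
  qed
  then have "(\<integral>\<^sup>+x. (h x)\<^sup>2 \<partial>M) \<le> (\<integral>\<^sup>+x. (SUP n. (min (h x) (of_nat n))\<^sup>2) \<partial>M)"
    by (intro nn_integral_mono)
  also have "\<dots> = (SUP n. \<integral>\<^sup>+x. (min (h x) (of_nat n))\<^sup>2 \<partial>M)"
  proof (rule nn_integral_monotone_convergence_SUP)
    show "incseq (\<lambda>n x. (min (h x) (of_nat n))\<^sup>2)"
      by (auto simp: incseq_def le_fun_def intro!: power_mono min.mono)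
  qed simp
  also have "\<dots> \<le> ennreal C" by (rule SUP_least) (rule step)
  finally show ?thesis unfolding h_def .
qed

lemma closed_indicator_limit:
  fixes F :: "real set"
  assumes "closed F"
  obtains u :: "nat \<Rightarrow> real \<Rightarrow> real" where "\<And>n. continuous_on UNIV (u n)"
    "\<And>n x. \<bar>u n x\<bar> \<le> 1" "\<And>x. (\<lambda>n. u n x) \<longlonglongrightarrow> indicator F x"
\<comment> \<open>\<open>infdist x {} = 0\<close>, so the distance to \<open>F\<close> is of use only when \<open>F\<close> is nonempty\<close>
proof (cases "F = {}")
  case True
  then show ?thesis by (intro that[of "\<lambda>_ _. 0"]) auto
next
  case False
  show ?thesis
  proof (rule that[of "\<lambda>n x. max 0 (1 - real n * infdist x F)"])
    fix x
    show "(\<lambda>n. max 0 (1 - real n * infdist x F)) \<longlonglongrightarrow> indicator F x"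
    proof (cases "x \<in> F")
      case True
      then show ?thesis by simp
    next
      assume "x \<notin> F"
      then have pos: "0 < infdist x F"
        using assms False in_closed_iff_infdist_zero infdist_nonneg by (metis less_eq_real_def)
      then obtain k where k: "1 < real k * infdist x F"
        using reals_Archimedean3 by blast
      have "eventually (\<lambda>n. max 0 (1 - real n * infdist x F) = indicator F x) sequentially"
      proof (rule eventually_sequentiallyI)
        fix n assume "k \<le> n"
        then have "real k * infdist x F \<le> real n * infdist x F"
          using pos by (intro mult_right_mono) auto
        then show "max 0 (1 - real n * infdist x F) = indicator F x"
          using k \<open>x \<notin> F\<close> by simp
      qed
      then show ?thesis by (rule tendsto_eventually)
    qed
  qed (auto intro!: continuous_intros simp: infdist_nonneg)
qed

lemma continuous_on_trig_polynomial:
  assumes "trig_polynomial p"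
  shows "continuous_on A p"
  using assms unfolding trig_polynomial_def by (auto intro!: continuous_intros)

section \<open>Measures with square summable Fourier coefficients\<close>

text \<open>
  The bound \<open>S\<close> is imposed on all finite partial sums over \<open>\<int>\<close>: this is the form that the
  estimate for trigonometric polynomials uses.
\<close>

locale square_summable_Fourier =
  fixes \<nu> :: "real measure" and S :: real
  assumes finite: "finite_measure \<nu>" and sets: "sets \<nu> = sets circle_borel"
    and Fourier: "finite K \<Longrightarrow> (\<Sum>k\<in>K. (cmod (LINT \<theta>|\<nu>. cis (of_int k * \<theta>)))\<^sup>2) \<le> S"
begin

abbreviation dominated :: "(real \<Rightarrow> real) \<Rightarrow> bool" where
  "dominated \<equiv> L2_dominated (S / (2 * pi)) circle_lebesgue \<nu>"

lemma S_nonneg: "0 \<le> S"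
  using Fourier[of "{}"] by simp

lemma space: "space \<nu> = {0..<2 * pi}"
  using sets_eq_imp_space_eq[OF sets] by (simp add: circle_borel_def space_restrict_space)

lemma sets_lebesgue: "sets \<nu> = sets circle_lebesgue"
  using sets sets_circle_lebesgue by simp

lemma borel_lebesgue: "f \<in> borel_measurable borel \<Longrightarrow> f \<in> borel_measurable circle_lebesgue"
  using measurable_circle[OF sets_circle_lebesgue] .

lemma dominated_limit:
  assumes "\<And>n::nat. u n \<in> borel_measurable borel" "f \<in> borel_measurable borel"
    and "\<And>n \<theta>. \<theta> \<in> {0..<2 * pi} \<Longrightarrow> \<bar>u n \<theta>\<bar> \<le> B"
    and "AE \<theta> in circle_lebesgue. (\<lambda>n. u n \<theta>) \<longlonglongrightarrow> f \<theta>" and "AE \<theta> in \<nu>. (\<lambda>n. u n \<theta>) \<longlonglongrightarrow> f \<theta>"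
    and "\<And>n. dominated (u n)"
  shows "dominated f"
  using borel_lebesgue[OF assms(1)] borel_lebesgue[OF assms(2)] assms(3-)
  by (rule L2_dominated_limit[OF finite_measure_circle_lebesgue finite sets_lebesgue])
    (auto simp: space_circle_lebesgue)

text \<open>
  If \<open>c\<close> are the coefficients of \<open>f\<close> and \<open>a\<close> the integrals of the characters against \<open>\<nu>\<close>, then
  \<open>\<integral> f d\<nu> = \<Sum> c k * a k\<close>. Cauchy-Schwarz separates the two factors, and Parseval turns
  \<open>\<Sum> |c k|\<^sup>2\<close> into the \<open>L\<^sup>2\<close> norm of \<open>f\<close>.
\<close>

lemma dominated_trig_polynomial:
  assumes "trig_polynomial (\<lambda>\<theta>. complex_of_real (f \<theta>))"
  shows "dominated f"
proof -
  obtain K c where K: "finite K"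
      and f: "\<And>\<theta>. complex_of_real (f \<theta>) = (\<Sum>k\<in>K. c k * cis (of_int k * \<theta>))"
    using assms unfolding trig_polynomial_def by metis
  let ?a = "\<lambda>k. LINT \<theta>|\<nu>. cis (of_int k * \<theta>)"
  have int: "integrable \<nu> (\<lambda>\<theta>. cis (of_int k * \<theta>))" for k
    by (rule integrable_bounded_circle[where B = 1]) (auto simp: finite sets)
  have "complex_of_real (LINT \<theta>|\<nu>. f \<theta>) = (LINT \<theta>|\<nu>. (\<Sum>k\<in>K. c k * cis (of_int k * \<theta>)))"
    unfolding f[symmetric] by (rule integral_complex_of_real[symmetric])
  also have "\<dots> = (\<Sum>k\<in>K. c k * ?a k)"
    using int by (simp add: Bochner_Integration.integral_sum)
  finally have "\<bar>LINT \<theta>|\<nu>. f \<theta>\<bar> = cmod (\<Sum>k\<in>K. c k * ?a k)"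
    by (metis norm_of_real)
  also have "\<dots> \<le> (\<Sum>k\<in>K. cmod (c k) * cmod (?a k))"
    by (rule order_trans[OF norm_sum]) (simp add: norm_mult)
  finally have "(LINT \<theta>|\<nu>. f \<theta>)\<^sup>2 \<le> (\<Sum>k\<in>K. cmod (c k) * cmod (?a k))\<^sup>2"
    by (subst power2_abs[symmetric]) (rule power_mono, auto)
  also have "\<dots> \<le> (\<Sum>k\<in>K. (cmod (c k))\<^sup>2) * (\<Sum>k\<in>K. (cmod (?a k))\<^sup>2)"
    by (rule Cauchy_Schwarz_ineq_sum)
  also have "\<dots> \<le> (\<Sum>k\<in>K. (cmod (c k))\<^sup>2) * S"
    using K by (intro mult_left_mono Fourier) (auto intro: sum_nonneg)
  also have "\<dots> = S / (2 * pi) * (2 * pi * (\<Sum>k\<in>K. (cmod (c k))\<^sup>2))"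
    by simp
  also have "2 * pi * (\<Sum>k\<in>K. (cmod (c k))\<^sup>2) = (LINT \<theta>|circle_lebesgue. (f \<theta>)\<^sup>2)"
    unfolding Parseval_trig_polynomial[OF K, symmetric] f[symmetric] by simp
  finally show ?thesis unfolding L2_dominated_def .
qed

lemma dominated_loop:
  assumes g: "continuous_on UNIV g" and loop: "g 0 = g (2 * pi)"
  shows "dominated g"
proof -
  have g': "continuous_on {0..2 * pi} g"
    using g continuous_on_subset by blast
  have "\<exists>f. trig_polynomial (\<lambda>\<theta>. complex_of_real (f \<theta>)) \<and>
      (\<forall>\<theta>\<in>{0..2 * pi}. \<bar>g \<theta> - f \<theta>\<bar> < inverse (real (Suc n)))" for n
    by (rule trig_polynomial_uniform_approx[OF g' loop, of "inverse (real (Suc n))"]) auto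
  then obtain f where f: "\<And>n. trig_polynomial (\<lambda>\<theta>. complex_of_real (f n \<theta>))"
      "\<And>n \<theta>. \<theta> \<in> {0..2 * pi} \<Longrightarrow> \<bar>g \<theta> - f n \<theta>\<bar> < inverse (real (Suc n))"
    by metis
  have "bounded (g ` {0..2 * pi})"
    by (intro compact_imp_bounded compact_continuous_image g') simp
  then obtain B where B: "\<And>\<theta>. \<theta> \<in> {0..2 * pi} \<Longrightarrow> \<bar>g \<theta>\<bar> \<le> B"
    unfolding bounded_iff real_norm_def by blast
  have lim: "(\<lambda>n. f n \<theta>) \<longlonglongrightarrow> g \<theta>" if "\<theta> \<in> {0..<2 * pi}" for \<theta>
  proof (rule metric_LIMSEQ_I)
    fix r :: real assume "0 < r"
    then obtain N where N: "inverse (real (Suc N)) < r"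
      using reals_Archimedean by blast
    have "dist (f n \<theta>) (g \<theta>) < r" if "N \<le> n" for n
    proof -
      have "inverse (real (Suc n)) \<le> inverse (real (Suc N))" using that by simp
      moreover have "\<bar>g \<theta> - f n \<theta>\<bar> < inverse (real (Suc n))"
        using \<open>\<theta> \<in> {0..<2 * pi}\<close> by (intro f(2)) auto
      ultimately show ?thesis using N unfolding dist_real_def by linarith
    qed
    then show "\<exists>N. \<forall>n\<ge>N. dist (f n \<theta>) (g \<theta>) < r" by blast
  qed
  show ?thesis
  proof (rule dominated_limit)
    show "f n \<in> borel_measurable borel" for n
    proof -
      have "f n = (\<lambda>\<theta>. Re (complex_of_real (f n \<theta>)))" by simp
      then show ?thesis
        using continuous_on_trig_polynomial[OF f(1)] continuous_on_Re borel_measurable_continuous_onI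
        by metis
    qed
    show "g \<in> borel_measurable borel" using g by (rule borel_measurable_continuous_onI)
    show "\<bar>f n \<theta>\<bar> \<le> B + 1" if "\<theta> \<in> {0..<2 * pi}" for n \<theta>
    proof -
      have "inverse (real (Suc n)) \<le> 1" by (simp add: field_simps)
      then show ?thesis using f(2)[of \<theta> n] B[of \<theta>] that by auto
    qed
    show "AE \<theta> in circle_lebesgue. (\<lambda>n. f n \<theta>) \<longlonglongrightarrow> g \<theta>" "AE \<theta> in \<nu>. (\<lambda>n. f n \<theta>) \<longlonglongrightarrow> g \<theta>"
      using lim by (auto intro!: AE_I2 simp: space space_circle_lebesgue)
    show "dominated (f n)" for n using f(1) by (rule dominated_trig_polynomial)
  qed
qed

text \<open>
  The seam is the point \<open>0\<close>, at which the circle is cut open to \<open>[0, 2\<pi>)\<close>. A continuous function on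
  the line descends to the circle only if it agrees at the endpoints; multiplication by a cutoff
  that vanishes there enforces this. The sine of the half angle serves because \<open>0\<close> is its only
  zero in \<open>[0, 2\<pi>)\<close>.
\<close>

definition seam_cutoff :: "nat \<Rightarrow> real \<Rightarrow> real" where
  "seam_cutoff n \<theta> = min 1 (real n * \<bar>sin (\<theta> / 2)\<bar>)"

lemma seam_cutoff:
  shows "continuous_on A (seam_cutoff n)" "seam_cutoff n 0 = 0" "seam_cutoff n (2 * pi) = 0"
    "0 \<le> seam_cutoff n \<theta>" "seam_cutoff n \<theta> \<le> 1"
  by (auto simp: seam_cutoff_def[abs_def] intro!: continuous_intros)

lemma seam_cutoff_limit:
  assumes "\<theta> \<in> {0<..<2 * pi}"
  shows "(\<lambda>n. seam_cutoff n \<theta>) \<longlonglongrightarrow> 1"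
proof -
  have "0 < sin (\<theta> / 2)" using assms by (intro sin_gt_zero) auto
  then obtain k where k: "1 < real k * \<bar>sin (\<theta> / 2)\<bar>"
    using reals_Archimedean3[of "\<bar>sin (\<theta> / 2)\<bar>"] by auto
  have "eventually (\<lambda>n. seam_cutoff n \<theta> = 1) sequentially"
  proof (rule eventually_sequentiallyI)
    fix n assume "k \<le> n"
    then have "real k * \<bar>sin (\<theta> / 2)\<bar> \<le> real n * \<bar>sin (\<theta> / 2)\<bar>"
      by (intro mult_right_mono) auto
    then show "seam_cutoff n \<theta> = 1" using k by (simp add: seam_cutoff_def)
  qed
  then show ?thesis by (rule tendsto_eventually)
qed

lemma AE_lebesgue_not_seam: "AE \<theta> in circle_lebesgue. \<theta> \<noteq> 0"
  unfolding circle_lebesgue_def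
  using AE_lborel_singleton[of 0] by (subst AE_restrict_space_iff) auto

text \<open>
  An atom of \<open>\<nu>\<close> at the seam would obstruct the removal of the cutoff. The functions
  \<open>1 - seam_cutoff n\<close> are continuous on the circle and decrease to the indicator of the seam,
  which is Lebesgue null, so the domination inequality shows that the seam has mass zero.
\<close>

lemma AE_not_seam: "AE \<theta> in \<nu>. \<theta> \<noteq> 0"
proof -
  interpret finite_measure \<nu> by (rule finite)
  have 0: "{0} \<in> sets \<nu>"
    unfolding sets circle_borel_def by (subst sets_restrict_space_iff) auto
  have "dominated (indicator {0})"
  proof (rule dominated_limit[where u = "\<lambda>n \<theta>. 1 - seam_cutoff n \<theta>"])
    show "dominated (\<lambda>\<theta>. 1 - seam_cutoff n \<theta>)" for n
      by (rule dominated_loop) (auto intro!: continuous_intros seam_cutoff simp: seam_cutoff)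
    show "\<bar>1 - seam_cutoff n \<theta>\<bar> \<le> 1" for n \<theta>
      using seam_cutoff(4,5)[of n \<theta>] by auto
    have "(\<lambda>n. 1 - seam_cutoff n \<theta>) \<longlonglongrightarrow> indicator {0} \<theta>" if "\<theta> \<in> {0..<2 * pi}" for \<theta>
    proof (cases "\<theta> = 0")
      case True
      then show ?thesis by (simp add: seam_cutoff)
    next
      case False
      then show ?thesis
        using tendsto_diff[OF tendsto_const seam_cutoff_limit[of \<theta>], of 1] that by auto
    qed
    then show "AE \<theta> in circle_lebesgue. (\<lambda>n. 1 - seam_cutoff n \<theta>) \<longlonglongrightarrow> indicator {0} \<theta>"
      "AE \<theta> in \<nu>. (\<lambda>n. 1 - seam_cutoff n \<theta>) \<longlonglongrightarrow> indicator {0} \<theta>"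
      by (auto intro!: AE_I2 simp: space space_circle_lebesgue)
  qed (auto intro!: borel_measurable_continuous_onI continuous_intros seam_cutoff)
  moreover have "(LINT \<theta>|circle_lebesgue. (indicator {0} \<theta> :: real)\<^sup>2) = 0"
    using AE_lebesgue_not_seam by (intro integral_eq_zero_AE) (auto elim!: eventually_mono)
  ultimately have "measure \<nu> {0} = 0"
    using 0 by (auto simp: L2_dominated_def)
  then have "{0} \<in> null_sets \<nu>" using 0 by (auto simp: emeasure_eq_measure)
  then show ?thesis by (rule AE_not_in[THEN eventually_mono]) auto
qed

lemma dominated_continuous:
  assumes g: "continuous_on UNIV g" and B: "\<And>\<theta>. \<bar>g \<theta>\<bar> \<le> B"
  shows "dominated g"
proof (rule dominated_limit[where u = "\<lambda>n \<theta>. g \<theta> * seam_cutoff n \<theta>"])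
  show "dominated (\<lambda>\<theta>. g \<theta> * seam_cutoff n \<theta>)" for n
    by (rule dominated_loop) (auto intro!: continuous_intros seam_cutoff g simp: seam_cutoff)
  show "\<bar>g \<theta> * seam_cutoff n \<theta>\<bar> \<le> B" for n \<theta>
    using mult_mono[OF B[of \<theta>] seam_cutoff(5)[of n \<theta>]] seam_cutoff(4)[of n \<theta>]
      order_trans[OF abs_ge_zero B[of \<theta>]] by (simp add: abs_mult)
  have lim: "(\<lambda>n. g \<theta> * seam_cutoff n \<theta>) \<longlonglongrightarrow> g \<theta>" if "\<theta> \<in> {0<..<2 * pi}" for \<theta>
    using tendsto_mult[OF tendsto_const seam_cutoff_limit[OF that], of "g \<theta>"] by simp
  show "AE \<theta> in circle_lebesgue. (\<lambda>n. g \<theta> * seam_cutoff n \<theta>) \<longlonglongrightarrow> g \<theta>"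
    using AE_lebesgue_not_seam AE_space
    by eventually_elim (rule lim, auto simp: space_circle_lebesgue)
  show "AE \<theta> in \<nu>. (\<lambda>n. g \<theta> * seam_cutoff n \<theta>) \<longlonglongrightarrow> g \<theta>"
    using AE_not_seam AE_space by eventually_elim (rule lim, auto simp: space)
qed (auto intro!: borel_measurable_continuous_onI continuous_intros seam_cutoff g)

text \<open>
  The indicator of \<open>K\<close> is an everywhere limit of bounded continuous functions. It therefore
  satisfies the domination inequality, which here reads \<open>\<nu>(K)\<^sup>2 \<le> C m(K) = 0\<close>.
\<close>

lemma compact_null_imp_null:
  assumes K: "compact K" and null: "emeasure lborel (K \<inter> {0..<2 * pi}) = 0"
  shows "emeasure \<nu> (K \<inter> {0..<2 * pi}) = 0"
proof -
  interpret finite_measure \<nu> by (rule finite)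
  have K_sets: "K \<inter> {0..<2 * pi} \<in> sets \<nu>"
    unfolding sets circle_borel_def using K
    by (subst sets_restrict_space_iff) (auto intro: borel_compact)
  obtain u :: "nat \<Rightarrow> real \<Rightarrow> real" where u: "\<And>n. continuous_on UNIV (u n)"
      "\<And>n x. \<bar>u n x\<bar> \<le> 1" "\<And>x. (\<lambda>n. u n x) \<longlonglongrightarrow> indicator K x"
    using closed_indicator_limit[OF compact_imp_closed[OF K]] by blast
  have "dominated (indicator K)"
  proof (rule dominated_limit[of u])
    show "(indicator K :: real \<Rightarrow> real) \<in> borel_measurable borel"
      using K by (intro borel_measurable_indicator borel_compact)
  qed (use u in \<open>auto intro: borel_measurable_continuous_onI dominated_continuous\<close>)
  moreover have "(LINT \<theta>|circle_lebesgue. (indicator K \<theta> :: real)\<^sup>2) = measure lborel (K \<inter> {0..<2 * pi})"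
    unfolding circle_lebesgue_def
    by (subst integral_restrict_space) (auto simp: indicator_inter_arith[symmetric] power2_eq_square K borel_compact Int_commute)
  moreover have "(LINT \<theta>|\<nu>. indicator K \<theta> :: real) = measure \<nu> (K \<inter> {0..<2 * pi})"
    by (simp add: space)
  ultimately have "measure \<nu> (K \<inter> {0..<2 * pi}) = 0"
    using null by (simp add: L2_dominated_def measure_def)
  then show ?thesis by (simp add: emeasure_eq_measure)
qed

text \<open>
  By inner regularity it is enough to treat compact subsets of a null set. Regularity is a property
  of Borel measures on a Polish space, so \<open>\<nu>\<close> is first pushed forward to the whole line.
\<close>

lemma absolutely_continuous: "absolutely_continuous circle_lebesgue \<nu>"
  unfolding absolutely_continuous_def
proof
  fix A assume A: "A \<in> null_sets circle_lebesgue"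
  interpret finite_measure \<nu> by (rule finite)
  let ?\<mu> = "distr \<nu> borel (\<lambda>\<theta>. \<theta>)"
  have id: "(\<lambda>\<theta>. \<theta>) \<in> measurable \<nu> borel" by (rule measurable_circle[OF sets]) simp
  have A_sub: "A \<subseteq> {0..<2 * pi}" and A_sets: "A \<in> sets \<nu>" and A_borel: "A \<in> sets borel"
    using A unfolding sets_lebesgue
    by (auto simp: null_sets_def circle_lebesgue_def sets_restrict_space_iff)
  have A_null: "emeasure lborel A = 0"
    using A A_sub by (auto simp: null_sets_def circle_lebesgue_def emeasure_restrict_space)
  have emeasure: "emeasure ?\<mu> B = emeasure \<nu> (B \<inter> {0..<2 * pi})" if "B \<in> sets borel" for B
    using that id by (simp add: emeasure_distr space)
  interpret \<mu>: finite_measure ?\<mu> using id by (rule finite_measure_distr)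
  have "emeasure \<nu> A = emeasure ?\<mu> A"
    using A_sub A_borel by (simp add: emeasure Int_absorb2)
  also have "\<dots> = (SUP K\<in>{K. K \<subseteq> A \<and> compact K}. emeasure ?\<mu> K)"
    using A_borel by (intro inner_regular) auto
  also have "\<dots> = (SUP K\<in>{K. K \<subseteq> A \<and> compact K}. 0)"
  proof (rule SUP_cong)
    fix K assume K: "K \<in> {K. K \<subseteq> A \<and> compact K}"
    then have "emeasure lborel (K \<inter> {0..<2 * pi}) \<le> emeasure lborel A"
      using A_borel by (intro emeasure_mono) auto
    then have "emeasure \<nu> (K \<inter> {0..<2 * pi}) = 0"
      using K A_null by (intro compact_null_imp_null) auto
    then show "emeasure ?\<mu> K = 0" using K by (simp add: emeasure borel_compact)
  qed simp
  also have "\<dots> = 0" by (auto intro!: SUP_eq_const)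
  finally show "A \<in> null_sets \<nu>" using A_sets by auto
qed

text \<open>
  A Lebesgue measurable function is the limit of continuous functions outside a Lebesgue null
  set, which is \<open>\<nu>\<close>-null by absolute continuity. Clipping to \<open>[- B, B]\<close> makes these functions
  uniformly bounded without changing the limit.
\<close>

lemma dominated_bounded_borel:
  assumes f: "f \<in> borel_measurable borel" and B: "\<And>\<theta>. \<bar>f \<theta>\<bar> \<le> B"
  shows "dominated f"
proof -
  have "f measurable_on UNIV"
    using f by (intro lebesgue_measurable_imp_measurable_on) (auto simp: measurable_completion)
  then obtain N g where N: "negligible N" and g: "\<And>n. continuous_on UNIV (g n)"
      and lim: "\<And>\<theta>. \<theta> \<notin> N \<Longrightarrow> (\<lambda>n. g n \<theta>) \<longlonglongrightarrow> f \<theta>"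
    unfolding measurable_on_def by auto
  let ?u = "\<lambda>n \<theta>. max (- B) (min B (g n \<theta>))"
  have B0: "0 \<le> B" using order_trans[OF abs_ge_zero B] .
  have lim': "(\<lambda>n. ?u n \<theta>) \<longlonglongrightarrow> f \<theta>" if "\<theta> \<notin> N" for \<theta>
  proof -
    have "max (- B) (min B (f \<theta>)) = f \<theta>" using B[of \<theta>] by auto
    moreover have "(\<lambda>n. ?u n \<theta>) \<longlonglongrightarrow> max (- B) (min B (f \<theta>))"
      by (intro tendsto_intros lim[OF that])
    ultimately show ?thesis by simp
  qed
  have "AE \<theta> in completion lborel. \<theta> \<notin> N"
    using N by (intro AE_not_in) (simp add: negligible_iff_null_sets)
  then have "AE \<theta> in lborel. \<theta> \<notin> N" by (simp add: AE_completion_iff)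
  then have "AE \<theta> in circle_lebesgue. \<theta> \<notin> N"
    unfolding circle_lebesgue_def by (subst AE_restrict_space_iff) auto
  then have ae: "AE \<theta> in circle_lebesgue. (\<lambda>n. ?u n \<theta>) \<longlonglongrightarrow> f \<theta>"
    by (rule eventually_mono) (rule lim')
  show ?thesis
  proof (rule dominated_limit[OF _ f _ ae])
    show "AE \<theta> in \<nu>. (\<lambda>n. ?u n \<theta>) \<longlonglongrightarrow> f \<theta>"
      using absolutely_continuous_AE[OF sets_lebesgue absolutely_continuous ae] .
    show "?u n \<in> borel_measurable borel" for n
      by (intro borel_measurable_continuous_onI continuous_intros g)
    show "\<bar>?u n \<theta>\<bar> \<le> B" for n \<theta> using B0 by auto
    show "dominated (?u n)" for n
      by (rule dominated_continuous[where B = B]) (use B0 in \<open>auto intro!: continuous_intros g\<close>)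
  qed
qed

lemma dominated_bounded:
  assumes f: "f \<in> borel_measurable circle_lebesgue" and B: "\<And>\<theta>. \<bar>f \<theta>\<bar> \<le> B"
  shows "dominated f"
proof -
  let ?f = "\<lambda>\<theta>. indicator {0..<2 * pi} \<theta> *\<^sub>R f \<theta>"
  have "?f \<in> borel_measurable borel"
    using f borel_measurable_restrict_space_iff[of "{0..<2 * pi}" lborel f]
    by (simp add: circle_lebesgue_def)
  moreover have "\<bar>?f \<theta>\<bar> \<le> B" for \<theta>
    using B[of \<theta>] order_trans[OF abs_ge_zero B[of \<theta>]] by (auto simp: indicator_def)
  ultimately have "dominated ?f" by (rule dominated_bounded_borel)
  moreover have "(LINT \<theta>|\<nu>. ?f \<theta>) = (LINT \<theta>|\<nu>. f \<theta>)"
    by (rule Bochner_Integration.integral_cong) (auto simp: space)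
  moreover have "(LINT \<theta>|circle_lebesgue. (?f \<theta>)\<^sup>2) = (LINT \<theta>|circle_lebesgue. (f \<theta>)\<^sup>2)"
    by (rule Bochner_Integration.integral_cong) (auto simp: space_circle_lebesgue)
  ultimately show ?thesis by (simp only: L2_dominated_def)
qed

lemma square_integrable_density:
  "(\<integral>\<^sup>+\<theta>. (RN_deriv circle_lebesgue \<nu> \<theta>)\<^sup>2 \<partial>circle_lebesgue) \<le> ennreal (S / (2 * pi))"
  by (rule nn_integral_RN_deriv_square_le[OF finite_measure_circle_lebesgue finite
        sets_lebesgue absolutely_continuous])
    (auto intro: dominated_bounded simp: S_nonneg)

end

section \<open>Covariances and Bessel's inequality\<close>

definition square_integrable :: "'w measure \<Rightarrow> ('w \<Rightarrow> complex) \<Rightarrow> bool" where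
  "square_integrable M Y \<longleftrightarrow>
     Y \<in> borel_measurable M \<and> integrable M (\<lambda>\<omega>. (cmod (Y \<omega>))\<^sup>2)"

lemma integrable_mult_cnj:
  assumes "square_integrable M Y" "square_integrable M Z"
  shows "integrable M (\<lambda>\<omega>. Y \<omega> * cnj (Z \<omega>))"
proof (rule Bochner_Integration.integrable_bound)
  show "integrable M (\<lambda>\<omega>. (cmod (Y \<omega>))\<^sup>2 + (cmod (Z \<omega>))\<^sup>2)"
    using assms by (auto simp: square_integrable_def)
  have "cmod a * cmod b \<le> (cmod a)\<^sup>2 + (cmod b)\<^sup>2" for a b
  proof -
    have "2 * (cmod a * cmod b) \<le> (cmod a)\<^sup>2 + (cmod b)\<^sup>2"
      using sum_squares_bound[of "cmod a" "cmod b"] by simp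
    moreover have "0 \<le> cmod a * cmod b" by simp
    ultimately show ?thesis by linarith
  qed
  then show "AE \<omega> in M. norm (Y \<omega> * cnj (Z \<omega>)) \<le> norm ((cmod (Y \<omega>))\<^sup>2 + (cmod (Z \<omega>))\<^sup>2)"
    by (auto simp: norm_mult)
  have "(\<lambda>\<omega>. cnj (Z \<omega>)) \<in> borel_measurable M"
    using assms(2) unfolding square_integrable_def
    by (intro borel_measurable_continuous_on[where f = cnj] continuous_intros) auto
  then show "(\<lambda>\<omega>. Y \<omega> * cnj (Z \<omega>)) \<in> borel_measurable M"
    using assms(1) by (auto simp: square_integrable_def)
qed

lemma cov_eq_cnj: "cov M Y Z = cnj (cov M Z Y)"
proof -
  have "cov M Y Z = (LINT \<omega>|M. cnj (Z \<omega> * cnj (Y \<omega>)))"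
    unfolding cov_def by (simp add: mult.commute)
  then show ?thesis unfolding cov_def by (simp only: Bochner_Integration.integral_cnj)
qed

lemma cov_sum_right:
  assumes "square_integrable M Y" "\<And>i. i \<in> F \<Longrightarrow> square_integrable M (Z i)"
  shows "cov M Y (\<lambda>\<omega>. \<Sum>i\<in>F. Z i \<omega>) = (\<Sum>i\<in>F. cov M Y (Z i))"
  unfolding cov_def using assms
  by (simp add: cnj_sum sum_distrib_left Bochner_Integration.integral_sum integrable_mult_cnj)

lemma square_integrable_sum:
  assumes "finite F" "\<And>i. i \<in> F \<Longrightarrow> square_integrable M (Z i)"
  shows "square_integrable M (\<lambda>\<omega>. \<Sum>i\<in>F. Z i \<omega>)"
proof -
  have eq: "(\<lambda>\<omega>. complex_of_real ((cmod (\<Sum>i\<in>F. Z i \<omega>))\<^sup>2)) =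
      (\<lambda>\<omega>. \<Sum>i\<in>F. \<Sum>j\<in>F. Z i \<omega> * cnj (Z j \<omega>))"
    unfolding complex_norm_square cnj_sum sum_product ..
  have "integrable M (\<lambda>\<omega>. \<Sum>i\<in>F. \<Sum>j\<in>F. Z i \<omega> * cnj (Z j \<omega>))"
    using assms by (intro Bochner_Integration.integrable_sum integrable_mult_cnj)
  then have "integrable M (\<lambda>\<omega>. Re (complex_of_real ((cmod (\<Sum>i\<in>F. Z i \<omega>))\<^sup>2)))"
    unfolding eq[symmetric] by (rule integrable_Re)
  moreover have "(\<lambda>\<omega>. \<Sum>i\<in>F. Z i \<omega>) \<in> borel_measurable M"
    using assms by (intro borel_measurable_sum) (auto simp: square_integrable_def)
  ultimately show ?thesis by (simp add: square_integrable_def del: of_real_power)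
qed

lemma cov_self: "cov M Y Y = complex_of_real (LINT \<omega>|M. (cmod (Y \<omega>))\<^sup>2)"
  unfolding cov_def complex_norm_square[symmetric] by (rule integral_complex_of_real)

lemma Cauchy_Schwarz_cov:
  assumes Y: "square_integrable M Y" and Z: "square_integrable M Z"
  shows "(cmod (cov M Y Z))\<^sup>2 \<le> Re (cov M Y Y) * Re (cov M Z Z)"
proof -
  have [measurable]: "Y \<in> borel_measurable M" "Z \<in> borel_measurable M"
    using assms by (auto simp: square_integrable_def)
  have YZ: "integrable M (\<lambda>\<omega>. cmod (Y \<omega>) * cmod (Z \<omega>))"
    using integrable_norm[OF integrable_mult_cnj[OF assms]] by (simp add: norm_mult)
  let ?I = "LINT \<omega>|M. cmod (Y \<omega>) * cmod (Z \<omega>)"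
  have "(\<integral>\<^sup>+\<omega>. ennreal (cmod (Y \<omega>)) * ennreal (cmod (Z \<omega>)) \<partial>M)\<^sup>2
      \<le> (\<integral>\<^sup>+\<omega>. (ennreal (cmod (Y \<omega>)))\<^sup>2 \<partial>M) * (\<integral>\<^sup>+\<omega>. (ennreal (cmod (Z \<omega>)))\<^sup>2 \<partial>M)"
    by (rule Cauchy_Schwarz_nn_integral) measurable
  then have "ennreal (?I\<^sup>2) \<le> ennreal (Re (cov M Y Y) * Re (cov M Z Z))"
    using Y Z YZ
    by (simp add: nn_integral_eq_integral ennreal_power ennreal_mult'[symmetric] cov_self
        square_integrable_def ennreal_mult[symmetric])
  then have "?I\<^sup>2 \<le> Re (cov M Y Y) * Re (cov M Z Z)"
    by (subst (asm) ennreal_le_iff) (auto simp: cov_self)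
  moreover have "cmod (cov M Y Z) \<le> ?I"
    unfolding cov_def by (rule order_trans[OF integral_norm_bound]) (simp add: norm_mult)
  then have "(cmod (cov M Y Z))\<^sup>2 \<le> ?I\<^sup>2" by (intro power_mono) auto
  ultimately show ?thesis by linarith
qed

text \<open>
  Only a family with equal variances and equal covariances with \<open>Y\<close> is considered, so it suffices to
  test \<open>Y\<close> against the sum \<open>W\<close> of the family: with \<open>N = card F\<close> and \<open>s = cov Y Y\<close> one has
  \<open>cov Y W = N r\<close> and, by orthogonality, \<open>cov W W = N s\<close>. Cauchy-Schwarz becomes
  \<open>N\<^sup>2 |r|\<^sup>2 \<le> N s\<^sup>2\<close>.
\<close>

lemma Bessel_orthogonal_family:
  assumes "finite F" and Y: "square_integrable M Y" and Z: "\<And>i. i \<in> F \<Longrightarrow> square_integrable M (Z i)"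
    and orth: "\<And>i j. \<lbrakk>i \<in> F; j \<in> F; i \<noteq> j\<rbrakk> \<Longrightarrow> cov M (Z i) (Z j) = 0"
    and var: "\<And>i. i \<in> F \<Longrightarrow> cov M (Z i) (Z i) = cov M Y Y"
    and r: "\<And>i. i \<in> F \<Longrightarrow> cov M Y (Z i) = r"
  shows "real (card F) * (cmod r)\<^sup>2 \<le> (cmod (cov M Y Y))\<^sup>2"
proof -
  let ?W = "\<lambda>\<omega>. \<Sum>i\<in>F. Z i \<omega>"
  have W: "square_integrable M ?W" using assms(1) Z by (rule square_integrable_sum)
  have s: "0 \<le> Re (cov M Y Y)" "Im (cov M Y Y) = 0" by (auto simp: cov_self)
  have YW: "cov M Y ?W = of_nat (card F) * r"
    using cov_sum_right[of M Y F Z] Y Z r by simp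
  have ZW: "cov M ?W (Z i) = cov M Y Y" if "i \<in> F" for i
  proof -
    have "cov M (Z i) ?W = (\<Sum>j\<in>F. cov M (Z i) (Z j))"
      using Z that by (intro cov_sum_right) auto
    also have "\<dots> = (\<Sum>j\<in>{i}. cov M (Z i) (Z j))"
      using that assms(1) orth by (intro sum.mono_neutral_right) auto
    finally have "cov M (Z i) ?W = cov M Y Y" using var[OF that] by simp
    then show ?thesis using s by (subst cov_eq_cnj) (simp add: complex_eq_iff)
  qed
  have WW: "cov M ?W ?W = of_nat (card F) * cov M Y Y"
    using cov_sum_right[of M ?W F Z] W Z ZW by simp
  have "(real (card F) * cmod r)\<^sup>2 \<le> Re (cov M Y Y) * (real (card F) * Re (cov M Y Y))"
    using Cauchy_Schwarz_cov[OF Y W] unfolding YW WW by (simp add: norm_mult)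
  then have "real (card F) * (real (card F) * (cmod r)\<^sup>2) \<le> real (card F) * (Re (cov M Y Y))\<^sup>2"
    by (simp add: power2_eq_square mult_ac)
  moreover have "cmod (cov M Y Y) = Re (cov M Y Y)" using s by (simp add: cmod_eq_Re)
  ultimately show ?thesis
    by (cases "card F = 0") (auto simp: mult_le_cancel_left_pos)
qed

section \<open>Covariance decay along the tree\<close>

context rooted_tree
begin

lemma walk_rev: "walk u p v \<Longrightarrow> walk v (rev p) u"
  unfolding walk_def by (auto simp: hd_rev last_rev successively_rev insert_commute)

lemma gdist_commute: "gdist u v = gdist v u"
proof -
  have "(\<exists>p. walk u p v \<and> length p = n) \<longleftrightarrow> (\<exists>p. walk v p u \<and> length p = n)" for n
    using walk_rev length_rev by metis
  then show ?thesis unfolding gdist_def by simp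
qed

lemma gdist_root_ray: "rooted_ray \<xi> \<Longrightarrow> gdist (\<xi> n) root = n"
  using gdist_commute[of "\<xi> n" root] unfolding rooted_ray_def
  by (metis diff_zero zero_le)

lemma preceq_ray:
  assumes "\<sigma> \<preceq> \<delta>" "gdist \<sigma> \<delta> = n"
  obtains \<xi> where "rooted_ray \<xi>" "\<xi> (gdist \<sigma> root) = \<sigma>" "\<xi> (gdist \<sigma> root + n) = \<delta>"
proof -
  obtain \<xi> i j where \<xi>: "rooted_ray \<xi>" and ij: "\<sigma> = \<xi> i" "\<delta> = \<xi> j"
    using assms(1) unfolding preceq_def comparable_def by auto
  have "i \<le> j"
    using assms(1) gdist_root_ray[OF \<xi>] unfolding preceq_def ij by simp
  then have "n = j - i" using \<xi> assms(2) unfolding ij rooted_ray_def by auto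
  then show ?thesis using that[OF \<xi>] gdist_root_ray[OF \<xi>] ij \<open>i \<le> j\<close> by simp
qed

text \<open>
  A ray passes through each level exactly once, because the distance from the root is the position
  on the ray.
\<close>

lemma not_comparable_same_level:
  assumes "gdist \<delta> root = gdist \<delta>' root" "\<delta> \<noteq> \<delta>'"
  shows "\<not> comparable \<delta> \<delta>'"
  using assms gdist_root_ray unfolding comparable_def by auto

text \<open>
  Bessel's inequality for the variable at \<open>\<sigma>\<close> and those at its descendants at distance \<open>n\<close>. A vertex with
  infinitely many such descendants forces the coefficient to vanish, since the inequality holds
  for finite subfamilies of every size.
\<close>

lemma Delta_mult_cov_le:
  assumes X: "branching_type_stationary M X" and \<nu>: "process_spectral_measure M X \<nu>"
  shows "Delta n * ennreal ((cmod (LINT \<theta>|\<nu>. exp (- \<i> * of_nat n * of_real \<theta>)))\<^sup>2)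
      \<le> ennreal ((measure \<nu> (space \<nu>))\<^sup>2)"
proof -
  define r where "r k = (LINT \<theta>|\<nu>. exp (- \<i> * of_nat k * of_real \<theta>))" for k :: nat
  have r0: "r 0 = of_real (measure \<nu> (space \<nu>))" by (simp add: r_def scaleR_conv_of_real)
  have ray: "cov M (X (\<xi> m)) (X (\<xi> (m + k))) = r k" if "rooted_ray \<xi>" for \<xi> m k
    using \<nu> that unfolding process_spectral_measure_def is_spectral_measure_def r_def by blast
  have X2: "square_integrable M (X \<sigma>)" if "\<sigma> \<in> V" for \<sigma>
    using X that unfolding branching_type_stationary_def centered_L2_process_def square_integrable_def
    by auto
  have card: "real (card F) * (cmod (r n))\<^sup>2 \<le> (measure \<nu> (space \<nu>))\<^sup>2"
    if \<sigma>: "\<sigma> \<in> V" and F: "finite F" "F \<subseteq> {\<delta>\<in>V. \<sigma> \<preceq> \<delta> \<and> gdist \<sigma> \<delta> = n}" for \<sigma> F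
  proof (cases "F = {}")
    case False
    have on_ray: "gdist \<delta> root = gdist \<sigma> root + n \<and> cov M (X \<sigma>) (X \<delta>) = r n \<and>
        cov M (X \<sigma>) (X \<sigma>) = r 0 \<and> cov M (X \<delta>) (X \<delta>) = r 0" if "\<delta> \<in> F" for \<delta>
    proof -
      obtain \<xi> where \<xi>: "rooted_ray \<xi>" "\<xi> (gdist \<sigma> root) = \<sigma>" "\<xi> (gdist \<sigma> root + n) = \<delta>"
        using preceq_ray[of \<sigma> \<delta> n] \<open>\<delta> \<in> F\<close> F(2) by blast
      show ?thesis
        using gdist_root_ray[OF \<xi>(1), of "gdist \<sigma> root + n"] ray[OF \<xi>(1), of "gdist \<sigma> root" n]
          ray[OF \<xi>(1), of "gdist \<sigma> root" 0] ray[OF \<xi>(1), of "gdist \<sigma> root + n" 0] \<xi>(2,3)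
        by simp
    qed
    have "cov M (X \<sigma>) (X \<sigma>) = r 0" using False on_ray by auto
    moreover have "real (card F) * (cmod (r n))\<^sup>2 \<le> (cmod (cov M (X \<sigma>) (X \<sigma>)))\<^sup>2"
    proof (rule Bessel_orthogonal_family[where Z = X])
      show "cov M (X \<delta>) (X \<delta>') = 0" if "\<delta> \<in> F" "\<delta>' \<in> F" "\<delta> \<noteq> \<delta>'" for \<delta> \<delta>'
      proof -
        have "\<not> comparable \<delta> \<delta>'"
          using that on_ray by (intro not_comparable_same_level) auto
        then show ?thesis
          using X that F unfolding branching_type_stationary_def by blast
      qed
    qed (use X2 \<sigma> F on_ray in auto)
    ultimately show ?thesis by (simp add: r0)
  qed simp
  have "emeasure (count_space UNIV) D * ennreal ((cmod (r n))\<^sup>2) \<le> ennreal ((measure \<nu> (space \<nu>))\<^sup>2)"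
    if \<sigma>: "\<sigma> \<in> V" and D: "D = {\<delta>\<in>V. \<sigma> \<preceq> \<delta> \<and> gdist \<sigma> \<delta> = n}" for \<sigma> D
  proof (cases "finite D")
    case True
    then show ?thesis
      using card[OF \<sigma> True] D
      by (simp add: ennreal_of_nat_eq_real_of_nat ennreal_mult[symmetric] ennreal_leI)
  next
    case False
    have "cmod (r n) = 0"
    proof (rule ccontr)
      assume "cmod (r n) \<noteq> 0"
      then obtain N :: nat where N: "(measure \<nu> (space \<nu>))\<^sup>2 < real N * (cmod (r n))\<^sup>2"
        using reals_Archimedean3[of "(cmod (r n))\<^sup>2"] by auto
      obtain F where "finite F" "card F = N" "F \<subseteq> D"
        using infinite_arbitrarily_large[OF False] by blast
      then show False using card[OF \<sigma>, of F] N D by simp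
    qed
    then show ?thesis by simp
  qed
  then show ?thesis
    unfolding Delta_def r_def[symmetric] SUP_mult_right_ennreal by (intro SUP_least) auto
qed

end

section \<open>Square summability of the Fourier coefficients\<close>

text \<open>
  As \<open>\<nu>\<close> is a positive measure, its coefficients at \<open>k\<close> and \<open>- k\<close> are conjugate. So a sum over
  integers splits into two sums over natural numbers, which accounts for the factor 2.
\<close>

lemma square_summable_Fourier_coefficients:
  assumes \<nu>: "finite_measure \<nu>" "sets \<nu> = sets circle_borel"
    and sum: "summable (\<lambda>n. (cmod (LINT \<theta>|\<nu>. exp (- \<i> * of_nat n * of_real \<theta>)))\<^sup>2)"
  shows "square_summable_Fourier \<nu>
      (2 * (\<Sum>n. (cmod (LINT \<theta>|\<nu>. exp (- \<i> * of_nat n * of_real \<theta>)))\<^sup>2))"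
proof (rule square_summable_Fourier.intro)
  fix K :: "int set" assume K: "finite K"
  define b where "b n = (cmod (LINT \<theta>|\<nu>. exp (- \<i> * of_nat n * of_real \<theta>)))\<^sup>2" for n :: nat
  have b: "summable b" "\<And>n. 0 \<le> b n" using sum by (simp_all only: b_def[abs_def] zero_le_power2)
  have exp: "exp (- \<i> * of_nat n * of_real \<theta>) = cis (of_int (- int n) * \<theta>)" for n \<theta>
    by (simp add: cis_conv_exp mult.assoc)
  have cis_uminus: "cmod (LINT \<theta>|\<nu>. cis (of_int (- k) * \<theta>)) = cmod (LINT \<theta>|\<nu>. cis (of_int k * \<theta>))" for k
  proof -
    have "(LINT \<theta>|\<nu>. cis (of_int (- k) * \<theta>)) = (LINT \<theta>|\<nu>. cnj (cis (of_int k * \<theta>)))"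
      by (simp only: cis_cnj of_int_minus mult_minus_left)
    then show ?thesis by (simp only: Bochner_Integration.integral_cnj complex_mod_cnj)
  qed
  have coeff: "(cmod (LINT \<theta>|\<nu>. cis (of_int k * \<theta>)))\<^sup>2 = b (nat \<bar>k\<bar>)" for k
  proof -
    consider "- int (nat \<bar>k\<bar>) = k" | "- int (nat \<bar>k\<bar>) = - k" by linarith
    then show ?thesis
      unfolding b_def exp by cases (simp_all only: cis_uminus)
  qed
  have part: "(\<Sum>k\<in>L. b (nat \<bar>k\<bar>)) \<le> suminf b" if "finite L" "inj_on (\<lambda>k. nat \<bar>k\<bar>) L" for L
  proof -
    have "(\<Sum>k\<in>L. b (nat \<bar>k\<bar>)) = (\<Sum>n\<in>(\<lambda>k. nat \<bar>k\<bar>) ` L. b n)"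
      using that by (simp add: sum.reindex)
    also have "\<dots> \<le> suminf b" using b that by (intro sum_le_suminf finite_imageI) simp_all
    finally show ?thesis .
  qed
  have "(\<Sum>k\<in>K. b (nat \<bar>k\<bar>)) = (\<Sum>k\<in>K \<inter> {0..}. b (nat \<bar>k\<bar>)) + (\<Sum>k\<in>K - {0..}. b (nat \<bar>k\<bar>))"
    using K by (rule sum.Int_Diff)
  also have "\<dots> \<le> suminf b + suminf b"
    using K by (intro add_mono part finite_Int finite_Diff) (auto simp: inj_on_def)
  finally show "(\<Sum>k\<in>K. (cmod (LINT \<theta>|\<nu>. cis (of_int k * \<theta>)))\<^sup>2) \<le>
      2 * (\<Sum>n. (cmod (LINT \<theta>|\<nu>. exp (- \<i> * of_nat n * of_real \<theta>)))\<^sup>2)"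
    unfolding coeff b_def[symmetric] by (simp only: mult_2)
qed (rule \<nu>)+

text \<open>
  The value \<open>d = 0\<close> is excluded through its reciprocal, which is infinite. For \<open>d = \<infinity>\<close> the first
  hypothesis forces \<open>b = 0\<close>, in accordance with \<open>1 / \<infinity> = 0\<close>.
\<close>

lemma ennreal_le_mult_inverse:
  fixes a b :: real and d :: ennreal
  assumes "d * ennreal b \<le> ennreal a" "1 / d \<noteq> top" "0 \<le> a" "0 \<le> b"
  shows "ennreal b \<le> ennreal a * (1 / d)"
proof (cases d)
  case (real x)
  have "d \<noteq> 0" using assms(2) by (auto simp: ennreal_divide_eq_top_iff)
  then have x: "0 < x" using real by auto
  then have "x * b \<le> a"
    using assms(1,3,4) unfolding real by (simp add: ennreal_mult[symmetric])
  then have "b \<le> a * (1 / x)" using x by (simp add: field_simps)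
  then have "ennreal b \<le> ennreal (a * (1 / x))" by (rule ennreal_leI)
  then show ?thesis
    using x assms(3) unfolding real
    by (simp add: ennreal_times_divide divide_ennreal)
next
  case top
  then show ?thesis using assms(1,4) by (cases "b = 0") (auto simp: ennreal_top_mult top_unique)
qed

theorem proposition1p4:
  fixes V :: "'v set" and E :: "'v set set" and root :: 'v
    and M :: "'w measure" and X :: "'v \<Rightarrow> 'w \<Rightarrow> complex" and \<nu> :: "real measure"
  assumes "rooted_tree V E root"
    and "infinite V"
    and "rooted_tree.no_leaves V E root"
    and "(\<Sum>n. 1 / rooted_tree.Delta V E root (Suc n)) < \<infinity>"
    and "prob_space M"
    and "rooted_tree.branching_type_stationary V E root M X"
    and "rooted_tree.process_spectral_measure V E root M X \<nu>"
  shows "absolutely_continuous circle_lebesgue \<nu> \<and>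
         (\<integral>\<^sup>+ \<theta>. (RN_deriv circle_lebesgue \<nu> \<theta>)\<^sup>2 \<partial>circle_lebesgue) < \<infinity>"
proof -
  interpret rooted_tree V E root by fact
  let ?b = "\<lambda>n::nat. (cmod (LINT \<theta>|\<nu>. exp (- \<i> * of_nat n * of_real \<theta>)))\<^sup>2"
  let ?a = "(measure \<nu> (space \<nu>))\<^sup>2"
  have fin: "1 / Delta (Suc n) \<noteq> top" for n
    using assms(4) ennreal_suminf_lessD[of "\<lambda>n. 1 / Delta (Suc n)" top n] by simp
  have "(\<Sum>n. ennreal (?b (Suc n))) \<le> (\<Sum>n. ennreal ?a * (1 / Delta (Suc n)))"
    by (rule suminf_le[OF ennreal_le_mult_inverse[OF Delta_mult_cov_le[OF assms(6,7)] fin]])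
      (rule zero_le_power2 summableI)+
  also have "\<dots> = ennreal ?a * (\<Sum>n. 1 / Delta (Suc n))" by (rule ennreal_suminf_cmult)
  also have "\<dots> < top" using assms(4) by (simp add: ennreal_mult_less_top)
  finally have "(\<Sum>n. ennreal (?b (Suc n))) \<noteq> top" by (rule less_imp_neq)
  then have "summable (\<lambda>n. ?b (Suc n))" by (rule summable_suminf_not_top[rotated]) (rule zero_le_power2)
  then have sum: "summable ?b" by (subst (asm) summable_Suc_iff)
  \<comment> \<open>The spectral measure is described through rays. If there were none, no two vertices would be
    comparable, and \<open>1 / Delta 1 = 1 / 0\<close> would be infinite.\<close>
  have "\<exists>\<xi>. rooted_ray \<xi>"
  proof (rule ccontr)
    assume "\<nexists>\<xi>. rooted_ray \<xi>"
    then have "Delta 1 \<le> 0"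
      unfolding Delta_def preceq_def comparable_def by (intro SUP_least) simp
    then show False using fin[of 0] by simp
  qed
  then obtain \<xi> where "rooted_ray \<xi>" ..
  then have "is_spectral_measure M (\<lambda>n. X (\<xi> n)) \<nu>"
    using assms(7) by (simp only: process_spectral_measure_def)
  then have "finite_measure \<nu>" "sets \<nu> = sets circle_borel"
    by (simp_all only: is_spectral_measure_def)
  then interpret square_summable_Fourier \<nu> "2 * (\<Sum>n. ?b n)"
    using sum by (rule square_summable_Fourier_coefficients)
  show ?thesis
    using absolutely_continuous le_less_trans[OF square_integrable_density ennreal_less_top]
    by simp
qed

end
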